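(* Let $\delta=(\lambda,v)$ be a purely balanced tangent to the symmetrized bidisc $G$ and let $\Phi_\omega$ solve $\mathrm{Car}\,\delta$ for the two distinct points $\omega=\omega_1,\omega_2\in\mathbb{T}$. For $j=1,2$ let $m_j$ be the automorphism of $\mathbb{D}$ such that $m_j\circ\Phi_{\omega_j}$ is well aligned at $\delta$, and let $$\Phi=(\Phi^1,\Phi^2)=(m_1\circ\Phi_{\omega_1},\,m_2\circ\Phi_{\omega_2}):G\to\mathbb{D}^2.$$ For every $t\in[0,1]$ and every function $\Theta$ in the Schur class of the bidisc, the function $$F=t\Phi^1+(1-t)\Phi^2+t(1-t)(\Phi^1-\Phi^2)^2\,\frac{\Theta\circ\Phi}{1-[(1-t)\Phi^1+t\Phi^2]\,\Theta\circ\Phi}$$ is a well-aligned Carathéodory extremal function for $\delta$.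
   Context: $\mathbb{D}$ is the open unit disc in $\mathbb{C}$ and $\mathbb{T}$ is the unit circle. The symmetrized bidisc is the domain $G=\{(z+w,zw): |z|<1,\ |w|<1\}\subset\mathbb{C}^2$, with coordinates $(s^1,s^2)$ (superscripts on points and on $\Phi$ are indices). A tangent to $G$ is a pair $\delta=(\lambda,v)$ with $\lambda\in G$ and $v\in\mathbb{C}^2$; it is nondegenerate if $v\ne0$. $\mathbb{D}(G)$ is the set of holomorphic maps from $G$ to $\mathbb{D}$. The Schur class of the bidisc is the set of holomorphic maps from $\mathbb{D}^2$ to the closed unit disc. For $F\in\mathbb{D}(G)$, $D_vF(\lambda)$ is the complex directional derivative $v_1\,\partial F/\partial s^1(\lambda)+v_2\,\partial F/\partial s^2(\lambda)$. Define $$|\delta|_{\rm car}=\sup_{F\in\mathbb{D}(G)}\frac{|D_vF(\lambda)|}{1-|F(\lambda)|^2}.$$ A function $F\in\mathbb{D}(G)$ solves $\mathrm{Car}\,\delta$, or is a Carathéodory extremal function for $\delta$, if this supremum is attained at $F$; it is well aligned at $\delta$ if moreover $F(\lambda)=0$ and $D_vF(\lambda)=|\delta|_{\rm car}$. For every solution $\varphi$ of $\mathrm{Car}\,\delta$ with $\delta$ nondegenerate there is exactly one automorphism $m$ of $\mathbb{D}$ such that $m\circ\varphi$ is well aligned at $\delta$. For $\omega\in\mathbb{T}$, $\Phi_\omega\in\mathbb{D}(G)$ is the function $\Phi_\omega(s^1,s^2)=\dfrac{2\omega s^2-s^1}{2-\omega s^1}$. A nondegenerate tangent $\delta$ is purely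 balanced if $\Phi_\omega$ solves $\mathrm{Car}\,\delta$ for exactly two values of $\omega\in\mathbb{T}$. An automorphism of $\mathbb{D}$ is a biholomorphic self-map of $\mathbb{D}$. *)

theory Defs
  imports "HOL-Analysis.Analysis"
begin

definition sym_bidisc :: "(complex \<times> complex) set" where
  "sym_bidisc = {(z + w, z * w) | z w. norm z < 1 \<and> norm w < 1}"

definition bidisc :: "(complex \<times> complex) set" where
  "bidisc = ball 0 1 \<times> ball 0 1"

text \<open>Holomorphy in two variables: the real Frechet derivative exists at every point of \<open>S\<close> and is
  complex linear. Since the derivative is taken with respect to the filter \<open>at x\<close>, this is the usual
  notion for open \<open>S\<close> only, and it is used only for the symmetrized bidisc and the bidisc.\<close>
definition holomorphic2_on :: "(complex \<times> complex \<Rightarrow> complex) \<Rightarrow> (complex \<times> complex) set \<Rightarrow> bool" where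
  "holomorphic2_on f S \<longleftrightarrow>
     (\<forall>x\<in>S. \<exists>a b. (f has_derivative (\<lambda>h. a * fst h + b * snd h)) (at x))"

text \<open>Holomorphic maps from the symmetrized bidisc to the open unit disc. Elements are total
  functions; their values outside \<open>sym_bidisc\<close> play no role.\<close>
definition disc_maps :: "(complex \<times> complex \<Rightarrow> complex) set" where
  "disc_maps = {F. holomorphic2_on F sym_bidisc \<and> F ` sym_bidisc \<subseteq> ball 0 1}"

definition schur_class :: "(complex \<times> complex \<Rightarrow> complex) set" where
  "schur_class = {\<Theta>. holomorphic2_on \<Theta> bidisc \<and> \<Theta> ` bidisc \<subseteq> cball 0 1}"

definition dir_deriv ::
    "(complex \<times> complex \<Rightarrow> complex) \<Rightarrow> complex \<times> complex \<Rightarrow> complex \<times> complex \<Rightarrow> complex" where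
  "dir_deriv F p v =
     fst v * deriv (\<lambda>z. F (z, snd p)) (fst p) + snd v * deriv (\<lambda>z. F (fst p, z)) (snd p)"

text \<open>A tangent \<open>(p, v)\<close> is passed as two arguments. For \<open>p\<close> in the symmetrized bidisc the
  supremum is over a nonempty set of reals that is bounded by the Schwarz-Pick lemma.\<close>
definition car_quotient ::
    "complex \<times> complex \<Rightarrow> complex \<times> complex \<Rightarrow> (complex \<times> complex \<Rightarrow> complex) \<Rightarrow> real" where
  "car_quotient p v F = norm (dir_deriv F p v) / (1 - (norm (F p))\<^sup>2)"

definition car_norm :: "complex \<times> complex \<Rightarrow> complex \<times> complex \<Rightarrow> real" where
  "car_norm p v = (SUP F\<in>disc_maps. car_quotient p v F)"

definition solves_Car ::
    "complex \<times> complex \<Rightarrow> complex \<times> complex \<Rightarrow> (complex \<times> complex \<Rightarrow> complex) \<Rightarrow> bool" where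
  "solves_Car p v F \<longleftrightarrow> F \<in> disc_maps \<and> car_quotient p v F = car_norm p v"

definition well_aligned ::
    "complex \<times> complex \<Rightarrow> complex \<times> complex \<Rightarrow> (complex \<times> complex \<Rightarrow> complex) \<Rightarrow> bool" where
  "well_aligned p v F \<longleftrightarrow>
     solves_Car p v F \<and> F p = 0 \<and> dir_deriv F p v = of_real (car_norm p v)"

definition Phi :: "complex \<Rightarrow> complex \<times> complex \<Rightarrow> complex" where
  "Phi \<omega> s = (2 * \<omega> * snd s - fst s) / (2 - \<omega> * fst s)"

definition purely_balanced :: "complex \<times> complex \<Rightarrow> complex \<times> complex \<Rightarrow> bool" where
  "purely_balanced p v \<longleftrightarrow>
     p \<in> sym_bidisc \<and> v \<noteq> 0 \<and> card {\<omega>. norm \<omega> = 1 \<and> solves_Car p v (Phi \<omega>)} = 2"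

definition disc_automorphism :: "(complex \<Rightarrow> complex) \<Rightarrow> bool" where
  "disc_automorphism m \<longleftrightarrow>
     m holomorphic_on ball 0 1 \<and> m ` ball 0 1 \<subseteq> ball 0 1 \<and>
     (\<exists>n. n holomorphic_on ball 0 1 \<and> n ` ball 0 1 \<subseteq> ball 0 1 \<and>
        (\<forall>z\<in>ball 0 1. n (m z) = z \<and> m (n z) = z))"

end

theory Submission
  imports Defs
begin

text \<open>Let \<open>u = (\<surd>t, \<surd>(1-t))\<close>, \<open>e = (\<surd>(1-t), -\<surd>t)\<close>, an orthonormal basis of \<open>\<complex>\<^sup>2\<close>. In this basis the
  strict contraction \<open>diag(z, w)\<close> is a matrix with rows \<open>(A, B)\<close>, \<open>(B, D)\<close>, where
  \<open>A = t z + (1-t) w\<close>, \<open>D = (1-t) z + t w\<close>, \<open>B = \<surd>(t(1-t)) (z - w)\<close>. So the formula of the theorem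
  is the linear fractional transformation \<open>A + B \<theta> (1 - D \<theta>)\<^sup>-\<^sup>1 B\<close>, which maps into the open disc
  when \<open>\<bar>\<theta>\<bar> \<le> 1\<close>. At the base point \<open>\<Phi>\<^sup>1 = \<Phi>\<^sup>2 = 0\<close>, so the last summand vanishes there to second
  order, and the derivative of \<open>F\<close> along \<open>v\<close> is the convex combination of two equal values.\<close>

section \<open>Contractivity of the linear fractional transformation\<close>

text \<open>The real matrix with rows \<open>(a, b)\<close> and \<open>(b, -a)\<close> is
  orthogonal, hence an isometry of the Euclidean norm on pairs of complex numbers. It is its own
  inverse, so it passes to the basis \<open>u, e\<close> and back.\<close>

lemma norm_rotation:
  fixes \<alpha> \<beta> :: complex and a b :: real
  assumes "a\<^sup>2 + b\<^sup>2 = 1"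
  shows "(norm (a * \<alpha> + b * \<beta>))\<^sup>2 + (norm (b * \<alpha> - a * \<beta>))\<^sup>2 = (norm \<alpha>)\<^sup>2 + (norm \<beta>)\<^sup>2"
proof -
  have "(norm (a * \<alpha> + b * \<beta>))\<^sup>2 + (norm (b * \<alpha> - a * \<beta>))\<^sup>2
      = (a\<^sup>2 + b\<^sup>2) * ((norm \<alpha>)\<^sup>2 + (norm \<beta>)\<^sup>2)"
    unfolding cmod_power2 by (simp add: power2_eq_square algebra_simps)
  then show ?thesis using assms by simp
qed

lemma norm_convex_combination_less_1:
  fixes z w :: complex and t :: real
  assumes "norm z < 1" "norm w < 1" "t \<in> {0..1}"
  shows "norm (of_real t * z + of_real (1 - t) * w) < 1"
proof -
  have "t *\<^sub>R z + (1 - t) *\<^sub>R w \<in> ball 0 1"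
    using assms by (intro convexD[OF convex_ball]) auto
  then show ?thesis by (simp add: scaleR_conv_of_real)
qed

lemma one_minus_mult_nonzero:
  fixes d \<theta> :: complex
  assumes "norm d < 1" "norm \<theta> \<le> 1"
  shows "1 - d * \<theta> \<noteq> 0"
proof
  assume "1 - d * \<theta> = 0"
  then have "norm d * norm \<theta> = 1"
    by (metis eq_iff_diff_eq_0 norm_mult norm_one)
  moreover have "norm d * norm \<theta> \<le> norm d"
    using assms(2) by (simp add: mult_left_le)
  ultimately show False using assms(1) by simp
qed

text \<open>A feedback loop: in the basis \<open>u, e\<close>, \<open>diag(z, w)\<close> sends the
  input \<open>(1, y)\<close> to an output \<open>(F, x)\<close>, and the loop is closed by
  \<open>y = \<theta> * x\<close>. Contractivity gives |F|^2 + |x|^2 \<le> r^2 (1 + |y|^2) with r <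
  1, and |y| \<le> |x| lets the \<open>x\<close> term cancel.\<close>

lemma norm_linear_fractional_less_1:
  fixes z w \<theta> :: complex and t :: real
  assumes z: "norm z < 1" and w: "norm w < 1" and \<theta>: "norm \<theta> \<le> 1" and t: "t \<in> {0..1}"
  shows "norm (of_real t * z + of_real (1 - t) * w
       + of_real (t * (1 - t)) * (z - w)\<^sup>2
         * (\<theta> / (1 - (of_real (1 - t) * z + of_real t * w) * \<theta>))) < 1"
    (is "norm ?F < 1")
proof -
  define a b where "a = sqrt t" and "b = sqrt (1 - t)"
  have ab: "a\<^sup>2 = t" "b\<^sup>2 = 1 - t" using t by (auto simp: a_def b_def)
  define d where "d = of_real (1 - t) * z + of_real t * w"
  \<comment> \<open>\<open>d\<close> is the entry \<open>D\<close>: a convex combination with the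
    weights exchanged, hence the instance at \<open>1 - t\<close>.\<close>
  have "norm d < 1"
    using norm_convex_combination_less_1[OF z w, of "1 - t"] t by (simp add: d_def)
  then have D: "1 - d * \<theta> \<noteq> 0" using \<theta> by (rule one_minus_mult_nonzero)
  \<comment> \<open>The solution of the loop equation \<open>x = B + d * y\<close>, where
    \<open>B = a * b * (z - w)\<close>.\<close>
  define x where "x = a * b * (z - w) / (1 - d * \<theta>)"
  define y where "y = \<theta> * x"
  \<comment> \<open>Standard coordinates of the input \<open>u + y e\<close>; in these,
    \<open>diag(z, w)\<close> acts coordinatewise.\<close>
  define \<alpha> \<beta> where "\<alpha> = a + b * y" and "\<beta> = b - a * y"
  have c: "complex_of_real t = a * a" "complex_of_real (1 - t) = b * b"
    using ab by (simp_all add: power2_eq_square flip: of_real_mult)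
  have "x * (1 - d * \<theta>) = a * b * (z - w)" using D by (simp add: x_def)
  then have "x = a * b * (z - w) + d * y" by (simp add: y_def algebra_simps)
  then have x: "x = b * (z * \<alpha>) - a * (w * \<beta>)"
    unfolding d_def c \<alpha>_def \<beta>_def by (simp add: algebra_simps)
  have "?F = a * a * z + b * b * w + a * b * (z - w) * (\<theta> * x)"
    unfolding d_def[symmetric] unfolding x_def of_real_mult c by (simp add: power2_eq_square)
  then have F: "?F = a * (z * \<alpha>) + b * (w * \<beta>)"
    unfolding y_def[symmetric] \<alpha>_def \<beta>_def by (simp add: algebra_simps)
  \<comment> \<open>The operator norm of \<open>diag(z, w)\<close>: one contraction factor for both
    coordinates, and \<open>r < 1\<close> makes the final bound strict.\<close>
  define r where "r = max (norm z) (norm w)"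
  have r: "0 \<le> r" "r < 1" "norm z \<le> r" "norm w \<le> r"
    using z w by (auto simp: r_def le_max_iff_disj)
  have r2: "r\<^sup>2 < 1" using r by (simp add: power_less_one_iff)
  have contr: "(norm (u * \<gamma>))\<^sup>2 \<le> r\<^sup>2 * (norm \<gamma>)\<^sup>2" if "norm u \<le> r" for u \<gamma> :: complex
    using that by (simp add: norm_mult power_mult_distrib mult_right_mono power_mono)
  have "(norm ?F)\<^sup>2 + (norm x)\<^sup>2 = (norm (z * \<alpha>))\<^sup>2 + (norm (w * \<beta>))\<^sup>2"
    unfolding F x by (rule norm_rotation) (simp add: ab)
  also have "\<dots> \<le> r\<^sup>2 * ((norm \<alpha>)\<^sup>2 + (norm \<beta>)\<^sup>2)"
    using contr[OF r(3), of \<alpha>] contr[OF r(4), of \<beta>] by (simp add: distrib_left)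
  \<comment> \<open>The isometry once more, now on the input side.\<close>
  also have "(norm \<alpha>)\<^sup>2 + (norm \<beta>)\<^sup>2 = 1 + (norm y)\<^sup>2"
    unfolding \<alpha>_def \<beta>_def using norm_rotation[of a b 1 y] ab by simp
  also have "r\<^sup>2 * (1 + (norm y)\<^sup>2) \<le> r\<^sup>2 + (norm x)\<^sup>2"
  proof -
    have "norm y \<le> norm x" using \<theta> by (simp add: y_def norm_mult mult_left_le_one_le)
    then have "r\<^sup>2 * (norm y)\<^sup>2 \<le> 1 * (norm x)\<^sup>2"
      using r2 by (intro mult_mono power_mono) auto
    then show ?thesis by (simp add: distrib_left)
  qed
  finally have "(norm ?F)\<^sup>2 < 1\<^sup>2" using r2 by simp
  then show ?thesis by (rule power_less_imp_less_base) simp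
qed

section \<open>Complex derivatives in two variables\<close>

text \<open>Holomorphy supplies a total derivative, while \<open>dir_deriv\<close> uses one-variable
  \<open>deriv\<close> on coordinate slices. The chain rule along the slices identifies the partial
  derivatives with \<open>a\<close> and \<open>b\<close>.\<close>

lemma dir_deriv_eq:
  assumes "(F has_derivative (\<lambda>h. a * fst h + b * snd h)) (at p)"
  shows "dir_deriv F p v = a * fst v + b * snd v"
proof -
  have 0: "(F has_derivative (\<lambda>h. a * fst h + b * snd h)) (at (fst p, snd p))"
    using assms by simp
  have "((\<lambda>z. F (z, snd p)) has_derivative (\<lambda>h. a * h)) (at (fst p))"
    using has_derivative_compose[OF has_derivative_Pair[OF has_derivative_ident
        has_derivative_const[of "snd p"]], of F _ "fst p" UNIV, OF 0] by simp
  moreover have "((\<lambda>z. F (fst p, z)) has_derivative (\<lambda>h. b * h)) (at (snd p))"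
    using has_derivative_compose[OF has_derivative_Pair[OF has_derivative_const[of "fst p"]
        has_derivative_ident], of F _ "snd p" UNIV, OF 0] by simp
  ultimately show ?thesis
    unfolding dir_deriv_def by (simp add: DERIV_imp_deriv has_field_derivative_def)
qed

lemma holomorphic2_onD:
  assumes "holomorphic2_on f S" "x \<in> S"
  obtains a b where "(f has_derivative (\<lambda>h. a * fst h + b * snd h)) (at x)"
  using assms unfolding holomorphic2_on_def by blast

lemma holomorphic2_on_const: "holomorphic2_on (\<lambda>_. c) S"
  unfolding holomorphic2_on_def by (auto intro!: exI[of _ 0])

lemma holomorphic2_on_add:
  assumes "holomorphic2_on f S" "holomorphic2_on g S"
  shows "holomorphic2_on (\<lambda>x. f x + g x) S"
  unfolding holomorphic2_on_def
proof
  fix x assume x: "x \<in> S"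
  obtain a b where f: "(f has_derivative (\<lambda>h. a * fst h + b * snd h)) (at x)"
    using holomorphic2_onD[OF assms(1) x] .
  obtain c d where g: "(g has_derivative (\<lambda>h. c * fst h + d * snd h)) (at x)"
    using holomorphic2_onD[OF assms(2) x] .
  from has_derivative_add[OF f g]
  have "((\<lambda>x. f x + g x) has_derivative (\<lambda>h. (a + c) * fst h + (b + d) * snd h)) (at x)"
    by (simp add: algebra_simps)
  then show "\<exists>a b. ((\<lambda>x. f x + g x) has_derivative (\<lambda>h. a * fst h + b * snd h)) (at x)" by blast
qed

lemma holomorphic2_on_mult:
  assumes "holomorphic2_on f S" "holomorphic2_on g S"
  shows "holomorphic2_on (\<lambda>x. f x * g x) S"
  unfolding holomorphic2_on_def
proof
  fix x assume x: "x \<in> S"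
  obtain a b where f: "(f has_derivative (\<lambda>h. a * fst h + b * snd h)) (at x)"
    using holomorphic2_onD[OF assms(1) x] .
  obtain c d where g: "(g has_derivative (\<lambda>h. c * fst h + d * snd h)) (at x)"
    using holomorphic2_onD[OF assms(2) x] .
  from has_derivative_mult[OF f g]
  have "((\<lambda>x. f x * g x) has_derivative
      (\<lambda>h. (f x * c + a * g x) * fst h + (f x * d + b * g x) * snd h)) (at x)"
    by (simp add: algebra_simps)
  then show "\<exists>a b. ((\<lambda>x. f x * g x) has_derivative (\<lambda>h. a * fst h + b * snd h)) (at x)" by blast
qed

lemma holomorphic2_on_diff:
  assumes "holomorphic2_on f S" "holomorphic2_on g S"
  shows "holomorphic2_on (\<lambda>x. f x - g x) S"
  using holomorphic2_on_add[OF assms(1) holomorphic2_on_mult[OF holomorphic2_on_const[of "-1"] assms(2)]]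
  by simp

lemma holomorphic2_on_inverse:
  assumes "holomorphic2_on f S" "\<And>x. x \<in> S \<Longrightarrow> f x \<noteq> 0"
  shows "holomorphic2_on (\<lambda>x. inverse (f x)) S"
  unfolding holomorphic2_on_def
proof
  fix x assume x: "x \<in> S"
  obtain a b where "(f has_derivative (\<lambda>h. a * fst h + b * snd h)) (at x)"
    using holomorphic2_onD[OF assms(1) x] .
  from Deriv.has_derivative_inverse[OF assms(2)[OF x] this]
  have "((\<lambda>x. inverse (f x)) has_derivative
      (\<lambda>h. (- inverse (f x) * a * inverse (f x)) * fst h
         + (- inverse (f x) * b * inverse (f x)) * snd h)) (at x)"
    by (simp add: algebra_simps)
  then show "\<exists>a b. ((\<lambda>x. inverse (f x)) has_derivative (\<lambda>h. a * fst h + b * snd h)) (at x)"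
    by blast
qed

lemma holomorphic2_on_divide:
  assumes "holomorphic2_on f S" "holomorphic2_on g S" "\<And>x. x \<in> S \<Longrightarrow> g x \<noteq> 0"
  shows "holomorphic2_on (\<lambda>x. f x / g x) S"
  unfolding divide_inverse
  using assms by (intro holomorphic2_on_mult holomorphic2_on_inverse)

text \<open>The chain rule preserves complex linearity; this makes \<Theta> \<circ> \<Phi>
  holomorphic.\<close>

lemma holomorphic2_on_compose_Pair:
  assumes "holomorphic2_on f S" "holomorphic2_on g S" "holomorphic2_on \<Theta> T"
    and "\<And>x. x \<in> S \<Longrightarrow> (f x, g x) \<in> T"
  shows "holomorphic2_on (\<lambda>x. \<Theta> (f x, g x)) S"
  unfolding holomorphic2_on_def
proof
  fix x assume x: "x \<in> S"
  obtain a b where f: "(f has_derivative (\<lambda>h. a * fst h + b * snd h)) (at x)"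
    using holomorphic2_onD[OF assms(1) x] .
  obtain c d where g: "(g has_derivative (\<lambda>h. c * fst h + d * snd h)) (at x)"
    using holomorphic2_onD[OF assms(2) x] .
  obtain k l where \<Theta>: "(\<Theta> has_derivative (\<lambda>h. k * fst h + l * snd h)) (at (f x, g x))"
    using holomorphic2_onD[OF assms(3) assms(4)[OF x]] .
  from has_derivative_compose[OF has_derivative_Pair[OF f g] \<Theta>]
  have "((\<lambda>x. \<Theta> (f x, g x)) has_derivative
      (\<lambda>h. (k * a + l * c) * fst h + (k * b + l * d) * snd h)) (at x)"
    by (simp add: algebra_simps)
  then show "\<exists>a b. ((\<lambda>x. \<Theta> (f x, g x)) has_derivative (\<lambda>h. a * fst h + b * snd h)) (at x)"
    by blast
qed

section \<open>Membership in \<open>disc_maps\<close> and first-order data at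
  \<open>p\<close>\<close>

theorem theorem5p3:
  fixes p v :: "complex \<times> complex"
    and \<omega>1 \<omega>2 :: complex
    and m1 m2 :: "complex \<Rightarrow> complex"
    and \<Phi>1 \<Phi>2 \<Theta> :: "complex \<times> complex \<Rightarrow> complex"
    and \<Phi> :: "complex \<times> complex \<Rightarrow> complex \<times> complex"
    and t :: real
  assumes "purely_balanced p v"
    and "norm \<omega>1 = 1" and "norm \<omega>2 = 1" and "\<omega>1 \<noteq> \<omega>2"
    and "solves_Car p v (Phi \<omega>1)" and "solves_Car p v (Phi \<omega>2)"
    and "disc_automorphism m1" and "well_aligned p v (m1 \<circ> Phi \<omega>1)"
    and "disc_automorphism m2" and "well_aligned p v (m2 \<circ> Phi \<omega>2)"
    and "\<Phi>1 = m1 \<circ> Phi \<omega>1" and "\<Phi>2 = m2 \<circ> Phi \<omega>2"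
    and "\<Phi> = (\<lambda>s. (\<Phi>1 s, \<Phi>2 s))"
    and "t \<in> {0..1}"
    and "\<Theta> \<in> schur_class"
  shows "well_aligned p v
    (\<lambda>s. of_real t * \<Phi>1 s + of_real (1 - t) * \<Phi>2 s
       + of_real (t * (1 - t)) * (\<Phi>1 s - \<Phi>2 s)\<^sup>2
         * (\<Theta> (\<Phi> s) / (1 - (of_real (1 - t) * \<Phi>1 s + of_real t * \<Phi>2 s) * \<Theta> (\<Phi> s))))"
proof -
  have F1: "well_aligned p v \<Phi>1" and F2: "well_aligned p v \<Phi>2" using assms by simp_all
  have p: "p \<in> sym_bidisc" using assms(1) by (simp add: purely_balanced_def)
  have h1: "holomorphic2_on \<Phi>1 sym_bidisc" and h2: "holomorphic2_on \<Phi>2 sym_bidisc"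
    and n1: "\<And>s. s \<in> sym_bidisc \<Longrightarrow> norm (\<Phi>1 s) < 1"
    and n2: "\<And>s. s \<in> sym_bidisc \<Longrightarrow> norm (\<Phi>2 s) < 1"
    using F1 F2 by (auto simp: well_aligned_def solves_Car_def disc_maps_def)
  have z1: "\<Phi>1 p = 0" and z2: "\<Phi>2 p = 0"
    and d1: "dir_deriv \<Phi>1 p v = car_norm p v" and d2: "dir_deriv \<Phi>2 p v = car_norm p v"
    and q1: "car_quotient p v \<Phi>1 = car_norm p v"
    using F1 F2 by (auto simp: well_aligned_def solves_Car_def)
  have bid: "(\<Phi>1 s, \<Phi>2 s) \<in> bidisc" if "s \<in> sym_bidisc" for s
    using n1 n2 that by (simp add: bidisc_def)
  have h\<Theta>: "holomorphic2_on \<Theta> bidisc" and n\<Theta>: "\<And>x. x \<in> bidisc \<Longrightarrow> norm (\<Theta> x) \<le> 1"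
    using assms(15) by (auto simp: schur_class_def)
  \<comment> \<open>Splitting off \<open>G\<close> avoids differentiating the quotient: at
    \<open>p\<close> only the existence of its derivative matters.\<close>
  define G where "G = (\<lambda>s. \<Theta> (\<Phi>1 s, \<Phi>2 s) / (1 - (of_real (1 - t) * \<Phi>1 s + of_real t * \<Phi>2 s) * \<Theta> (\<Phi>1 s, \<Phi>2 s)))"
  define F where "F = (\<lambda>s. of_real t * \<Phi>1 s + of_real (1 - t) * \<Phi>2 s
       + of_real (t * (1 - t)) * (\<Phi>1 s - \<Phi>2 s)\<^sup>2 * G s)"
  have den: "1 - (of_real (1 - t) * \<Phi>1 s + of_real t * \<Phi>2 s) * \<Theta> (\<Phi>1 s, \<Phi>2 s) \<noteq> 0"
    if "s \<in> sym_bidisc" for s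
    using norm_convex_combination_less_1[OF n1[OF that] n2[OF that], of "1 - t"] assms(14) n\<Theta>[OF bid[OF that]]
    by (intro one_minus_mult_nonzero) auto
  have hG: "holomorphic2_on G sym_bidisc"
    unfolding G_def
    by (intro holomorphic2_on_divide holomorphic2_on_diff holomorphic2_on_mult holomorphic2_on_add
        holomorphic2_on_const holomorphic2_on_compose_Pair[where T = bidisc] h1 h2 h\<Theta> den bid)
  have "holomorphic2_on F sym_bidisc"
    unfolding F_def power2_eq_square
    by (intro holomorphic2_on_diff holomorphic2_on_mult holomorphic2_on_add
        holomorphic2_on_const h1 h2 hG)
  moreover have "norm (F s) < 1" if "s \<in> sym_bidisc" for s
    unfolding F_def G_def
    by (rule norm_linear_fractional_less_1[OF n1[OF that] n2[OF that] n\<Theta>[OF bid[OF that]] assms(14)])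
  ultimately have F_disc: "F \<in> disc_maps" by (auto simp: disc_maps_def)
  obtain a b where L1: "(\<Phi>1 has_derivative (\<lambda>h. a * fst h + b * snd h)) (at p)"
    using holomorphic2_onD[OF h1 p] .
  obtain c d where L2: "(\<Phi>2 has_derivative (\<lambda>h. c * fst h + d * snd h)) (at p)"
    using holomorphic2_onD[OF h2 p] .
  obtain k l where LG: "(G has_derivative (\<lambda>h. k * fst h + l * snd h)) (at p)"
    using holomorphic2_onD[OF hG p] .
  \<comment> \<open>By the product rule every term coming from the last summand keeps a factor
    \<open>\<Phi>1 p - \<Phi>2 p = 0\<close>, so \<open>k\<close> and \<open>l\<close> drop
    out.\<close>
  have "(F has_derivative (\<lambda>h. (of_real t * a + of_real (1 - t) * c) * fst h
      + (of_real t * b + of_real (1 - t) * d) * snd h)) (at p)"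
    unfolding F_def power2_eq_square
    by (rule derivative_eq_intros L1 L2 LG refl)+ (simp add: z1 z2 fun_eq_iff algebra_simps)
  from dir_deriv_eq[OF this]
  have "dir_deriv F p v = of_real t * dir_deriv \<Phi>1 p v + of_real (1 - t) * dir_deriv \<Phi>2 p v"
    by (simp add: dir_deriv_eq[OF L1] dir_deriv_eq[OF L2] algebra_simps)
  then have dF: "dir_deriv F p v = car_norm p v"
    by (simp add: d1 d2 algebra_simps)
  have zF: "F p = 0" by (simp add: F_def z1 z2)
  \<comment> \<open>\<open>F\<close> and \<open>\<Phi>1\<close> have the same value and the same
    derivative along \<open>v\<close> at \<open>p\<close>, so \<open>F\<close> attains the supremum
    because \<open>\<Phi>1\<close> does.\<close>
  have "car_quotient p v F = car_quotient p v \<Phi>1"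
    by (simp add: car_quotient_def dF d1 zF z1)
  then have "well_aligned p v F"
    using F_disc dF zF q1 by (simp add: well_aligned_def solves_Car_def)
  then show ?thesis by (simp add: F_def G_def assms(13))
qed

end
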